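(* Let $n\ge 1$ be an integer. Then (a) $\displaystyle \Omega^\perp(4;1,2n)\ \ge\ \min\{\rho(4;\mathbb{C},n),\,2n-1\}$; and (b) $\displaystyle \Omega(4;1,2n)\ \ge\ \Big\lceil\tfrac12\min\{\rho(4;\mathbb{R},2n),\,2n-1\}\Big\rceil .$
   Context: A mass distribution on $\mathbb{R}^N$ is a finite (nonnegative) measure that is absolutely continuous with respect to Lebesgue measure. A regular $4$-fan $F_4$ in $\mathbb{R}^N$ is a union of $4$ half-hyperplanes with a common boundary $(N-2)$-dimensional affine subspace such that the angle between successive half-hyperplanes is $\pi/2$; the $4$ closed regions $S_0,\dots,S_3$ between successive half-hyperplanes are its regular $4$-sectors. It equipartitions a mass distribution $\mu$ if $\mu(S_i)=\frac14\mu(\mathbb{R}^N)$ for all $0\le i<4$. Let $F_4^\perp$ denote the linear span of the normal vectors of the half-hyperplanes of $F_4$ (a 2-dimensional subspace). Regular $4$-fans $F_4^1,\dots,F_4^k$ are linearly independent (respectively pairwise orthogonal) if the subspaces $F_4^{1\perp},\dots,F_4^{k\perp}$ are linearly independent, i.e. their sum is direct (respectively pairwise orthogonal). $\Omega(4;1,N)$ (respectively $\Omega^\perp(4;1,N)$) is the maximum $k\ge 0$ such that for any mass distribution $\mu$ on $\mathbb{R}^N$ there exist $k$ linearly independent (respectively pairwise orthogonal) regular $4$-fans in $\mathbb{R}^N$, each of which equipartitions $\mu$. For $\mathbb{F}=\mathbb{R}$ or $\mathbb{C}$, $V_k(\mathbb{F}^d)$ is the Stiefel manifold of $k$-tuples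 of vectors of $\mathbb{F}^d$ that are orthonormal for the standard (Euclidean, resp. Hermitian) inner product. Identify $\mathbb{R}^{2n}=\mathbb{C}^n$. For $r\in\{1,3\}$, $\mathbb{Z}_4$ acts freely on $V_k(\mathbb{R}^{2n})$ and on $V_k(\mathbb{C}^n)$, the generator acting by $(v_1,v_2,\dots,v_k)\mapsto(iv_1,i^rv_2,\dots,i^rv_k)$. Then $\rho(4;\mathbb{R},2n)$ (respectively $\rho(4;\mathbb{C},n)$) is the maximum $k$ such that, for some such $r$, the bundle $V_k(\mathbb{R}^{2n})/\mathbb{Z}_4\to L^{2n-1}(4)=S^{2n-1}/\mathbb{Z}_4$ (respectively $V_k(\mathbb{C}^n)/\mathbb{Z}_4\to L^{2n-1}(4)$), induced by $(v_1,\dots,v_k)\mapsto v_1$, admits a section; equivalently, there is a continuous map $s=(s_1,\dots,s_k)$ from $S^{2n-1}$ to $V_k(\mathbb{R}^{2n})$ (respectively to $V_k(\mathbb{C}^n)$) with $s_1(x)=x$ and $s_j(ix)=i^rs_j(x)$ for all $x$ and $2\le j\le k$. *)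

theory Defs
  imports "HOL-Analysis.Analysis"
begin

section \<open>Mass distributions and regular 4-fans\<close>

text \<open>The ambient space \<open>\<real>\<^sup>N\<close> is any Euclidean space type \<open>'a\<close> with \<open>N = DIM('a)\<close>.\<close>

definition mass_distribution :: "'a::euclidean_space measure \<Rightarrow> bool" where
  "mass_distribution \<mu> \<longleftrightarrow>
     finite_measure \<mu> \<and> sets \<mu> = sets borel \<and> absolutely_continuous lborel \<mu>"

text \<open>
  A fan is given by the common boundary \<open>A\<close> of its half-hyperplanes and by the unit vectors
  \<open>u 0, \<dots>, u 3\<close>, orthogonal to \<open>A\<close>, pointing from \<open>A\<close> into the successive half-hyperplanes.
\<close>

definition half_hyperplane :: "'a::euclidean_space set \<Rightarrow> 'a \<Rightarrow> 'a set" where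
  "half_hyperplane A v = {a + t *\<^sub>R v | a t. a \<in> A \<and> 0 \<le> t}"

text \<open>
  The indices of the directions are read cyclically modulo 4. Distinctness is needed because the
  angle condition alone would admit \<open>u 2 = u 0\<close>; together they force
  \<open>u 2 = - u 0\<close> and \<open>u 3 = - u 1\<close>.
\<close>

definition regular_4_fan :: "'a::euclidean_space set \<Rightarrow> (nat \<Rightarrow> 'a) \<Rightarrow> bool" where
  "regular_4_fan A u \<longleftrightarrow>
     affine A \<and> aff_dim A = int DIM('a) - 2 \<and>
     (\<forall>j<4. norm (u j) = 1 \<and> (\<forall>a\<in>A. \<forall>b\<in>A. orthogonal (u j) (a - b))) \<and>
     inj_on u {..<4} \<and>
     (\<forall>j<4. arccos (u j \<bullet> u (Suc j mod 4)) = pi / 2)"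

definition sector :: "'a::euclidean_space set \<Rightarrow> (nat \<Rightarrow> 'a) \<Rightarrow> nat \<Rightarrow> 'a set" where
  "sector A u j =
     {a + s *\<^sub>R u j + t *\<^sub>R u (Suc j mod 4) | a s t. a \<in> A \<and> 0 \<le> s \<and> 0 \<le> t}"

definition equipartitions ::
  "'a::euclidean_space set \<Rightarrow> (nat \<Rightarrow> 'a) \<Rightarrow> 'a measure \<Rightarrow> bool" where
  "equipartitions A u \<mu> \<longleftrightarrow>
     (\<forall>j<4. measure \<mu> (sector A u j) = 1 / 4 * measure \<mu> UNIV)"

definition normal_vectors :: "'a::euclidean_space set \<Rightarrow> 'a set" where
  "normal_vectors H = {v. \<forall>x\<in>H. \<forall>y\<in>H. orthogonal v (x - y)}"

definition fan_perp :: "'a::euclidean_space set \<Rightarrow> (nat \<Rightarrow> 'a) \<Rightarrow> 'a set" where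
  "fan_perp A u = span (\<Union>j<4. normal_vectors (half_hyperplane A (u j)))"

definition direct_family :: "nat \<Rightarrow> (nat \<Rightarrow> 'a::euclidean_space set) \<Rightarrow> bool" where
  "direct_family k W \<longleftrightarrow>
     (\<forall>w. (\<forall>i<k. w i \<in> W i) \<and> (\<Sum>i<k. w i) = 0 \<longrightarrow> (\<forall>i<k. w i = 0))"

definition orthogonal_family :: "nat \<Rightarrow> (nat \<Rightarrow> 'a::euclidean_space set) \<Rightarrow> bool" where
  "orthogonal_family k W \<longleftrightarrow>
     (\<forall>i<k. \<forall>j<k. i \<noteq> j \<longrightarrow> (\<forall>x\<in>W i. \<forall>y\<in>W j. orthogonal x y))"

text \<open>
  The sets below contain 0, and are bounded by \<open>DIM('a)\<close> since the spaces \<open>fan_perp\<close> are nonzero;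
  so \<^const>\<open>Max\<close> is taken over a finite nonempty set.
\<close>

definition Omega :: "'a::euclidean_space itself \<Rightarrow> nat" where
  "Omega _ = Max {k. \<forall>\<mu> :: 'a measure. mass_distribution \<mu> \<longrightarrow>
     (\<exists>A u. (\<forall>i<k. regular_4_fan (A i) (u i) \<and> equipartitions (A i) (u i) \<mu>) \<and>
            direct_family k (\<lambda>i. fan_perp (A i) (u i)))}"

definition Omega_perp :: "'a::euclidean_space itself \<Rightarrow> nat" where
  "Omega_perp _ = Max {k. \<forall>\<mu> :: 'a measure. mass_distribution \<mu> \<longrightarrow>
     (\<exists>A u. (\<forall>i<k. regular_4_fan (A i) (u i) \<and> equipartitions (A i) (u i) \<mu>) \<and>
            orthogonal_family k (\<lambda>i. fan_perp (A i) (u i)))}"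

section \<open>Stiefel manifolds and equivariant sections\<close>

text \<open>
  \<open>complex ^ 'n\<close> is both \<open>\<complex>\<^sup>n\<close> and \<open>\<real>\<^sup>2\<^sup>n\<close> for \<open>n = CARD('n)\<close>: its inner product \<open>\<bullet>\<close> is the real
  Euclidean one, the real part of the Hermitian one. A \<open>k\<close>-tuple is a function on \<open>nat\<close> of which
  only the values at \<open>1, \<dots>, k\<close> matter.
\<close>

definition hermitian_inner :: "complex ^ 'n::finite \<Rightarrow> complex ^ 'n \<Rightarrow> complex" where
  "hermitian_inner v w = (\<Sum>l\<in>UNIV. v $ l * cnj (w $ l))"

definition stiefel_real :: "nat \<Rightarrow> (nat \<Rightarrow> complex ^ 'n::finite) set" where
  "stiefel_real k =
     {v. \<forall>i\<in>{1..k}. \<forall>j\<in>{1..k}. v i \<bullet> v j = (if i = j then 1 else 0)}"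

definition stiefel_complex :: "nat \<Rightarrow> (nat \<Rightarrow> complex ^ 'n::finite) set" where
  "stiefel_complex k =
     {v. \<forall>i\<in>{1..k}. \<forall>j\<in>{1..k}. hermitian_inner (v i) (v j) = (if i = j then 1 else 0)}"

text \<open>
  Sections of \<open>V\<^sub>k / \<int>\<^sub>4 \<rightarrow> S\<^sup>2\<^sup>n\<^sup>-\<^sup>1 / \<int>\<^sub>4\<close> are described by their equivariant lifts
  \<open>S\<^sup>2\<^sup>n\<^sup>-\<^sup>1 \<rightarrow> V\<^sub>k\<close> with first component the identity; the generator of \<open>\<int>\<^sub>4\<close> acts on the \<open>j\<close>-th
  vector, \<open>j \<ge> 2\<close>, as multiplication by \<open>\<i> ^ r\<close>.
\<close>

definition Z4_section ::
  "(nat \<Rightarrow> complex ^ 'n::finite) set \<Rightarrow> nat \<Rightarrow> nat \<Rightarrow> (complex ^ 'n \<Rightarrow> nat \<Rightarrow> complex ^ 'n) \<Rightarrow> bool"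
where
  "Z4_section V k r s \<longleftrightarrow>
     (\<forall>j\<in>{1..k}. continuous_on (sphere 0 1) (\<lambda>x. s x j)) \<and>
     (\<forall>x\<in>sphere 0 1. s x \<in> V \<and> s x 1 = x \<and> (\<forall>j\<in>{2..k}. s (\<i> *s x) j = \<i> ^ r *s s x j))"

text \<open>
  The sets below contain 1 and are bounded by \<open>2 * CARD('n)\<close>, as longer orthonormal tuples do not
  exist.
\<close>

definition rho_real :: "'n::finite itself \<Rightarrow> nat" where
  "rho_real _ = Max {k. 1 \<le> k \<and>
     (\<exists>r\<in>{1, 3}. \<exists>s. Z4_section (stiefel_real k :: (nat \<Rightarrow> complex ^ 'n) set) k r s)}"

definition rho_complex :: "'n::finite itself \<Rightarrow> nat" where
  "rho_complex _ = Max {k. 1 \<le> k \<and>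
     (\<exists>r\<in>{1, 3}. \<exists>s. Z4_section (stiefel_complex k :: (nat \<Rightarrow> complex ^ 'n) set) k r s)}"

end

theory Submission
  imports Defs
begin

text \<open>
  Fix a plane with orthonormal basis \<open>e, f\<close>. For every rotated basis \<open>v, w\<close> of it choose hyperplanes
  orthogonal to \<open>v\<close> and to \<open>w\<close> that halve \<open>\<mu>\<close>. Opposite quadrants then have equal mass, and turning
  by a right angle exchanges the two values, so at some angle all four quadrants have equal mass.
  Thus every plane is the normal plane of an equipartitioning regular 4-fan, and \<open>\<real>\<^sup>2\<^sup>n\<close> is the
  orthogonal sum of \<open>n\<close> planes, so both \<open>\<Omega>\<close> and \<open>\<Omega>\<^sup>\<bottom>\<close> are at least \<open>n\<close>. On the other side, the lengths
  of orthonormal tuples bound \<open>\<rho>(4;\<complex>,n)\<close> by \<open>n\<close> and \<open>\<rho>(4;\<real>,2n)\<close> by \<open>2n\<close>.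
\<close>

section \<open>Quadrants\<close>

text \<open>Repeating the arguments, as in \<open>quadrant v v a a\<close>, gives a closed
  half-space, so facts about quadrants cover half-spaces too.\<close>

definition quadrant :: "'a::euclidean_space \<Rightarrow> 'a \<Rightarrow> real \<Rightarrow> real \<Rightarrow> 'a set" where
  "quadrant v w a b = {y. a \<le> y \<bullet> v \<and> b \<le> y \<bullet> w}"

lemma quadrant_borel [measurable]: "quadrant v w a b \<in> sets borel"
  unfolding quadrant_def by measurable

lemma quadrant_commute: "quadrant v w a b = quadrant w v b a"
  unfolding quadrant_def by auto

section \<open>Continuity of quadrant masses\<close>

text \<open>Hyperplanes are Lebesgue null, and absolute continuity passes this on to
  \<open>\<mu>\<close>. Hence boundaries of quadrants carry no mass.\<close>

lemma hyperplane_AE: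
  assumes \<mu>: "mass_distribution \<mu>" and "v \<noteq> 0"
  shows "AE y in \<mu>. y \<bullet> v \<noteq> c"
proof (rule absolutely_continuous_AE)
  have "negligible {y. v \<bullet> y = c}"
    using assms by (intro negligible_hyperplane) auto
  then have "{y. v \<bullet> y = c} \<in> null_sets lborel"
    by (simp add: negligible_iff_null_sets null_sets_completion_iff closed_hyperplane borel_closed)
  then show "AE y in lborel. y \<bullet> v \<noteq> c"
    by (rule AE_I') (auto simp: inner_commute)
qed (use \<mu> in \<open>auto simp: mass_distribution_def\<close>)

text \<open>Off the two boundary hyperplanes of the limit quadrant the indicators are eventually
  constant, so dominated convergence applies; the constant 1 is an integrable bound because
  \<open>\<mu>\<close> is finite.\<close>

lemma tendsto_measure_quadrant:
  assumes \<mu>: "mass_distribution \<mu>"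
    and lim: "v \<longlonglongrightarrow> v0" "w \<longlonglongrightarrow> w0" "a \<longlonglongrightarrow> a0" "b \<longlonglongrightarrow> b0"
    and nz: "v0 \<noteq> 0" "w0 \<noteq> 0"
  shows "(\<lambda>n. measure \<mu> (quadrant (v n) (w n) (a n) (b n))) \<longlonglongrightarrow> measure \<mu> (quadrant v0 w0 a0 b0)"
proof -
  interpret finite_measure \<mu>
    using \<mu> by (simp add: mass_distribution_def)
  have [measurable_cong]: "sets \<mu> = sets borel"
    using \<mu> by (simp add: mass_distribution_def)
  have sp: "space \<mu> = UNIV"
    using sets_eq_imp_space_eq[of \<mu> borel] \<mu> by (simp add: mass_distribution_def)
  have "(\<lambda>n. \<integral>y. indicator (quadrant (v n) (w n) (a n) (b n)) y \<partial>\<mu> :: real)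
      \<longlonglongrightarrow> (\<integral>y. indicator (quadrant v0 w0 a0 b0) y \<partial>\<mu>)"
  proof (rule integral_dominated_convergence[where w = "\<lambda>_. 1"])
    show "AE y in \<mu>. (\<lambda>n. indicator (quadrant (v n) (w n) (a n) (b n)) y :: real)
        \<longlonglongrightarrow> indicator (quadrant v0 w0 a0 b0) y"
      using hyperplane_AE[OF \<mu> nz(1), of a0] hyperplane_AE[OF \<mu> nz(2), of b0]
    proof eventually_elim
      case (elim y)
      have lv: "(\<lambda>n. y \<bullet> v n - a n) \<longlonglongrightarrow> y \<bullet> v0 - a0" and lw: "(\<lambda>n. y \<bullet> w n - b n) \<longlonglongrightarrow> y \<bullet> w0 - b0"
        by (intro tendsto_intros lim)+
      \<comment> \<open>A point off both hyperplanes satisfies both inequalities strictly or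
        violates one strictly, and strict inequalities persist for large \<open>n\<close>.\<close>
      consider "y \<bullet> v0 - a0 > 0 \<and> y \<bullet> w0 - b0 > 0" | "y \<bullet> v0 - a0 < 0" | "y \<bullet> w0 - b0 < 0"
        using elim by linarith
      then have "\<forall>\<^sub>F n in sequentially. (indicator (quadrant (v n) (w n) (a n) (b n)) y :: real)
          = indicator (quadrant v0 w0 a0 b0) y"
      proof cases
        case 1
        then have "\<forall>\<^sub>F n in sequentially. 0 < y \<bullet> v n - a n" "\<forall>\<^sub>F n in sequentially. 0 < y \<bullet> w n - b n"
          using order_tendstoD(1)[OF lv, of 0] order_tendstoD(1)[OF lw, of 0] by auto
        then show ?thesis
          by eventually_elim (use 1 in \<open>auto simp: quadrant_def indicator_def\<close>)
      next
        case 2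
        then show ?thesis
          using order_tendstoD(2)[OF lv, of 0]
          by (auto elim!: eventually_mono simp: quadrant_def indicator_def)
      next
        case 3
        then show ?thesis
          using order_tendstoD(2)[OF lw, of 0]
          by (auto elim!: eventually_mono simp: quadrant_def indicator_def)
      qed
      then show ?case
        by (rule tendsto_eventually)
    qed
  qed (auto simp: indicator_def)
  then show ?thesis
    by (simp add: sp)
qed

lemma continuous_on_measure_quadrant:
  fixes v w :: "'b::metric_space \<Rightarrow> 'a::euclidean_space"
  assumes \<mu>: "mass_distribution \<mu>"
    and cont: "continuous_on S v" "continuous_on S w" "continuous_on S a" "continuous_on S b"
    and nz: "\<And>p. p \<in> S \<Longrightarrow> v p \<noteq> 0" "\<And>p. p \<in> S \<Longrightarrow> w p \<noteq> 0"
  shows "continuous_on S (\<lambda>p. measure \<mu> (quadrant (v p) (w p) (a p) (b p)))"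
  using cont nz unfolding continuous_on_sequentially
  by (auto simp: comp_def intro!: tendsto_measure_quadrant[OF \<mu>])

section \<open>Bisecting hyperplanes\<close>

text \<open>A ball holding more than half of the mass forces a bisecting hyperplane in every
  direction to occur at bounded offset. One \<open>R\<close> serves all directions, which later
  makes the parameter space compact.\<close>

lemma ex_bisecting_hyperplane_bound:
  fixes \<mu> :: "'a::euclidean_space measure"
  assumes \<mu>: "mass_distribution \<mu>"
  obtains R where "\<And>v. norm v = 1 \<Longrightarrow> \<exists>a\<in>{-R..R}. measure \<mu> (quadrant v v a a) = measure \<mu> UNIV / 2"
proof (cases "measure \<mu> UNIV = 0")
  \<comment> \<open>No ball holds more than half of a zero mass, but then every hyperplane
    bisects.\<close>
  case True
  interpret finite_measure \<mu>
    using \<mu> by (simp add: mass_distribution_def)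
  have "measure \<mu> A = 0" for A
    using finite_measure_mono[of A UNIV] True \<mu> measure_nonneg[of \<mu> A]
    by (simp add: mass_distribution_def)
  then show ?thesis
    by (intro that[of 0]) auto
next
  case False
  interpret finite_measure \<mu>
    using \<mu> by (simp add: mass_distribution_def)
  have se: "sets \<mu> = sets borel"
    using \<mu> by (simp add: mass_distribution_def)
  let ?M = "measure \<mu> UNIV"
  have "(\<Union>n. cball (0::'a) (real n)) = UNIV"
    using real_arch_simple by (auto simp: dist_norm)
  moreover have "(\<lambda>n. measure \<mu> (cball 0 (real n))) \<longlonglongrightarrow> measure \<mu> (\<Union>n. cball 0 (real n))"
    by (rule finite_Lim_measure_incseq) (auto simp: se incseq_def)
  ultimately have "(\<lambda>n. measure \<mu> (cball 0 (real n))) \<longlonglongrightarrow> ?M"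
    by simp
  moreover have "?M / 2 < ?M"
    using False measure_nonneg[of \<mu> UNIV] by linarith
  ultimately have "\<forall>\<^sub>F n in sequentially. ?M / 2 < measure \<mu> (cball 0 (real n))"
    by (rule order_tendstoD(1))
  then obtain m where m: "?M / 2 < measure \<mu> (cball 0 (real m))"
    by (auto simp: eventually_sequentially)
  \<comment> \<open>The extra 1 makes the half-space at offset \<open>R\<close> disjoint from the
    closed ball.\<close>
  define R where "R = real m + 1"
  show ?thesis
  proof (rule that[of R])
    fix v :: 'a assume v: "norm v = 1"
    have le: "\<bar>y \<bullet> v\<bar> \<le> real m" if "y \<in> cball 0 (real m)" for y
      using Cauchy_Schwarz_ineq2[of y v] v that by auto
    have "measure \<mu> (quadrant v v R R) \<le> measure \<mu> (UNIV - cball 0 (real m))"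
      using le by (intro finite_measure_mono) (force simp: quadrant_def R_def se)+
    also have "\<dots> = ?M - measure \<mu> (cball 0 (real m))"
      by (intro finite_measure_Diff) (auto simp: se)
    finally have upper: "measure \<mu> (quadrant v v R R) \<le> ?M / 2"
      using m by linarith
    have "measure \<mu> (cball 0 (real m)) \<le> measure \<mu> (quadrant v v (-R) (-R))"
      using le by (intro finite_measure_mono) (force simp: quadrant_def R_def se)+
    then have lower: "?M / 2 \<le> measure \<mu> (quadrant v v (-R) (-R))"
      using m by linarith
    have "continuous_on {-R..R} (\<lambda>a. measure \<mu> (quadrant v v a a))"
      using v by (intro continuous_on_measure_quadrant[OF \<mu>] continuous_intros) auto
    then show "\<exists>a\<in>{-R..R}. measure \<mu> (quadrant v v a a) = ?M / 2"
      using IVT2'[of "\<lambda>a. measure \<mu> (quadrant v v a a)" R "?M / 2" "-R"] upper lower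
      by (force simp: R_def)
  qed
qed

text \<open>The two quadrants cover the half-space and overlap only in a null piece of the
  hyperplane where \<open>y \<bullet> w = b\<close>.\<close>

lemma measure_quadrant_split:
  assumes \<mu>: "mass_distribution \<mu>" and "w \<noteq> 0"
  shows "measure \<mu> (quadrant v w a b) + measure \<mu> (quadrant v (-w) a (-b))
    = measure \<mu> (quadrant v v a a)"
proof -
  interpret finite_measure \<mu>
    using \<mu> by (simp add: mass_distribution_def)
  have se: "sets \<mu> = sets borel"
    using \<mu> by (simp add: mass_distribution_def)
  have "measure \<mu> (quadrant v (-w) a (-b)) = measure \<mu> (quadrant v v a a - quadrant v w a b)"
    using hyperplane_AE[OF assms, of b]
    by (intro finite_measure_eq_AE) (auto simp: quadrant_def se elim!: eventually_mono)
  also have "\<dots> = measure \<mu> (quadrant v v a a) - measure \<mu> (quadrant v w a b)"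
    by (intro finite_measure_Diff) (auto simp: quadrant_def se)
  finally show ?thesis
    by simp
qed

lemma measure_quadrant_neg:
  assumes \<mu>: "mass_distribution \<mu>" and "v \<noteq> 0"
  shows "measure \<mu> (quadrant (-v) (-v) (-a) (-a)) = measure \<mu> UNIV - measure \<mu> (quadrant v v a a)"
proof -
  interpret finite_measure \<mu>
    using \<mu> by (simp add: mass_distribution_def)
  have se: "sets \<mu> = sets borel"
    using \<mu> by (simp add: mass_distribution_def)
  have "measure \<mu> (quadrant (-v) (-v) (-a) (-a)) = measure \<mu> (UNIV - quadrant v v a a)"
    using hyperplane_AE[OF assms, of a]
    by (intro finite_measure_eq_AE) (auto simp: quadrant_def se elim!: eventually_mono)
  also have "\<dots> = measure \<mu> UNIV - measure \<mu> (quadrant v v a a)"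
    by (intro finite_measure_Diff) (auto simp: se)
  finally show ?thesis .
qed

text \<open>Although bisecting hyperplanes are not unique, the slab between two parallel ones is null.\<close>

lemma measure_quadrant_cong1:
  assumes \<mu>: "mass_distribution \<mu>"
    and eq: "measure \<mu> (quadrant v v a a) = measure \<mu> (quadrant v v a' a')"
  shows "measure \<mu> (quadrant v w a b) = measure \<mu> (quadrant v w a' b)"
  using eq
proof (induction a a' rule: linorder_wlog)
  case (le a a')
  interpret finite_measure \<mu>
    using \<mu> by (simp add: mass_distribution_def)
  have se: "sets \<mu> = sets borel"
    using \<mu> by (simp add: mass_distribution_def)
  have "measure \<mu> (quadrant v w a b) - measure \<mu> (quadrant v w a' b)
      = measure \<mu> (quadrant v w a b - quadrant v w a' b)"
    using le by (intro finite_measure_Diff[symmetric]) (auto simp: quadrant_def se)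
  \<comment> \<open>The difference of the quadrants lies in the slab between the two parallel
    hyperplanes.\<close>
  also have "\<dots> \<le> measure \<mu> (quadrant v v a a - quadrant v v a' a')"
    by (intro finite_measure_mono) (auto simp: quadrant_def se)
  also have "\<dots> = measure \<mu> (quadrant v v a a) - measure \<mu> (quadrant v v a' a')"
    using le by (intro finite_measure_Diff) (auto simp: quadrant_def se)
  finally have "measure \<mu> (quadrant v w a b) \<le> measure \<mu> (quadrant v w a' b)"
    using le by simp
  moreover have "measure \<mu> (quadrant v w a' b) \<le> measure \<mu> (quadrant v w a b)"
    using le by (intro finite_measure_mono) (auto simp: quadrant_def se)
  ultimately show ?case
    by simp
qed simp

text \<open>The offsets are exchanged one at a time. For bisecting offsets this makes the quadrant
  mass a function of the frame alone.\<close>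

lemma measure_quadrant_cong:
  assumes \<mu>: "mass_distribution \<mu>"
    and "measure \<mu> (quadrant v v a a) = measure \<mu> (quadrant v v a' a')"
    and "measure \<mu> (quadrant w w b b) = measure \<mu> (quadrant w w b' b')"
  shows "measure \<mu> (quadrant v w a b) = measure \<mu> (quadrant v w a' b')"
  using measure_quadrant_cong1[OF \<mu> assms(2), of w b] measure_quadrant_cong1[OF \<mu> assms(3), of v a']
  by (simp add: quadrant_commute)

section \<open>The quarter-turn argument\<close>

text \<open>No continuous choice of bisecting offsets is made. All bisecting configurations are kept
  in one compact set, and connectedness of the interval of angles replaces the intermediate value
  theorem.\<close>

lemma ex_equal_quadrants:
  fixes \<mu> :: "'a::euclidean_space measure"
  assumes \<mu>: "mass_distribution \<mu>" and e: "norm e = 1" and f: "norm f = 1" and ef: "e \<bullet> f = 0"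
  obtains v w a b where "v \<in> span {e, f}" "w \<in> span {e, f}" "norm v = 1" "norm w = 1" "v \<bullet> w = 0"
    "measure \<mu> (quadrant v w a b) = measure \<mu> UNIV / 4"
    "measure \<mu> (quadrant v v a a) = measure \<mu> UNIV / 2"
    "measure \<mu> (quadrant w w b b) = measure \<mu> UNIV / 2"
proof -
  define v where "v t = cos t *\<^sub>R e + sin t *\<^sub>R f" for t
  define w where "w t = cos t *\<^sub>R f - sin t *\<^sub>R e" for t
  let ?M = "measure \<mu> UNIV"
  have ee: "e \<bullet> e = 1" "f \<bullet> f = 1" "f \<bullet> e = 0"
    using e f ef by (simp_all add: norm_eq_1 inner_commute)
  have nv: "norm (v t) = 1" and nw: "norm (w t) = 1" and vw: "v t \<bullet> w t = 0" for t
    using sin_cos_squared_add2[of t]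
    by (auto simp: v_def w_def norm_eq_1 inner_simps ee ef algebra_simps power2_eq_square)
  have nz: "v t \<noteq> 0" "w t \<noteq> 0" for t
    using nv[of t] nw[of t] by auto
  obtain R where R: "\<And>v. norm v = 1 \<Longrightarrow> \<exists>a\<in>{-R..R}. measure \<mu> (quadrant v v a a) = ?M / 2"
    using ex_bisecting_hyperplane_bound[OF \<mu>] by blast
  define G where "G = (\<lambda>(t, a, b). measure \<mu> (quadrant (v t) (w t) a b))"
  define B where "B = {0..pi/2} \<times> {-R..R} \<times> {-R..R}"
  \<comment> \<open>Triples of an angle and offsets for which both hyperplanes bisect.\<close>
  define K where "K = {p \<in> B. (\<lambda>(t, a, b). measure \<mu> (quadrant (v t) (v t) a a)) p = ?M / 2 \<and>
     (\<lambda>(t, a, b). measure \<mu> (quadrant (w t) (w t) b b)) p = ?M / 2}"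
  have cB: "compact B"
    unfolding B_def by (intro compact_Times compact_Icc)
  have cv: "continuous_on S (\<lambda>p. v (fst p))" "continuous_on S (\<lambda>p. w (fst p))"
    for S :: "(real \<times> real \<times> real) set"
    unfolding v_def w_def by (intro continuous_intros)+
  have cG: "continuous_on B G"
    unfolding G_def case_prod_beta
    by (intro continuous_on_measure_quadrant[OF \<mu>] continuous_intros cv nz)
  have "closed {p \<in> B. (\<lambda>(t, a, b). measure \<mu> (quadrant (v t) (v t) a a)) p = ?M / 2}"
    unfolding case_prod_beta
    by (intro continuous_closed_preimage_constant continuous_on_measure_quadrant[OF \<mu>]
        continuous_intros cv nz compact_imp_closed[OF cB])
  moreover have "closed {p \<in> B. (\<lambda>(t, a, b). measure \<mu> (quadrant (w t) (w t) b b)) p = ?M / 2}"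
    unfolding case_prod_beta
    by (intro continuous_closed_preimage_constant continuous_on_measure_quadrant[OF \<mu>]
        continuous_intros cv nz compact_imp_closed[OF cB])
  ultimately have "closed ({p \<in> B. (\<lambda>(t, a, b). measure \<mu> (quadrant (v t) (v t) a a)) p = ?M / 2} \<inter>
      {p \<in> B. (\<lambda>(t, a, b). measure \<mu> (quadrant (w t) (w t) b b)) p = ?M / 2})"
    by (rule closed_Int)
  also have "\<dots> = K"
    unfolding K_def by blast
  finally have "closed K" .
  \<comment> \<open>Projections of closed sets need not be closed; here the set lies in the compact
    box \<open>B\<close>.\<close>
  have cut: "closed (fst ` {p \<in> K. G p \<in> C})" if "closed C" for C
  proof -
    have "continuous_on K G"
      using cG by (rule continuous_on_subset) (auto simp: K_def)
    then have "closed (K \<inter> G -` C)"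
      using \<open>closed K\<close> that by (rule continuous_closed_preimage)
    then have "compact (B \<inter> (K \<inter> G -` C))"
      using cB by blast
    moreover have "B \<inter> (K \<inter> G -` C) = {p \<in> K. G p \<in> C}"
      by (auto simp: K_def)
    ultimately show ?thesis
      using compact_continuous_image[OF continuous_on_fst[OF continuous_on_id]] compact_imp_closed
      by metis
  qed
  \<comment> \<open>\<open>U\<close> and \<open>L\<close> hold the angles at which some bisecting
    offsets give a quadrant mass of at least, respectively at most, a quarter.\<close>
  define U where "U = fst ` {p \<in> K. G p \<in> {?M/4..}}"
  define L where "L = fst ` {p \<in> K. G p \<in> {..?M/4}}"
  have mem: "\<exists>a b. (t, a, b) \<in> K" if "t \<in> {0..pi/2}" for t
  proof -
    obtain a b where "a \<in> {-R..R}" "measure \<mu> (quadrant (v t) (v t) a a) = ?M / 2"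
      "b \<in> {-R..R}" "measure \<mu> (quadrant (w t) (w t) b b) = ?M / 2"
      using R[OF nv[of t]] R[OF nw[of t]] by blast
    then show ?thesis
      using that by (intro exI[of _ a] exI[of _ b]) (simp add: K_def B_def)
  qed
  have "{0..pi/2} \<subseteq> U \<union> L"
  proof
    fix t :: real assume "t \<in> {0..pi/2}"
    then obtain a b where "(t, a, b) \<in> K"
      using mem by blast
    then show "t \<in> U \<union> L"
      unfolding U_def L_def by (cases "?M / 4 \<le> G (t, a, b)") force+
  qed
  moreover have "closed U" "closed L"
    unfolding U_def L_def by (intro cut; simp)+
  moreover have "U \<inter> {0..pi/2} \<noteq> {} \<and> L \<inter> {0..pi/2} \<noteq> {}"
  proof -
    obtain a b where 0: "(0, a, b) \<in> K"
      using mem[of 0] by auto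
    obtain c d where 1: "(pi/2, c, d) \<in> K"
      using mem[of "pi/2"] by auto
    \<comment> \<open>A quarter turn takes the frame \<open>(e, f)\<close> to
      \<open>(f, -e)\<close>, whose quadrant completes the original one to a half-space normal to
      \<open>f\<close>.\<close>
    have v0: "v 0 = e" "w 0 = f" "v (pi/2) = f" "w (pi/2) = -e"
      by (simp_all add: v_def w_def)
    have e0: "e \<noteq> 0"
      using e by auto
    have a: "measure \<mu> (quadrant e e a a) = ?M / 2" and b: "measure \<mu> (quadrant f f b b) = ?M / 2"
      and c: "measure \<mu> (quadrant f f c c) = ?M / 2" and d: "measure \<mu> (quadrant (-e) (-e) d d) = ?M / 2"
      using 0 1 by (auto simp: K_def v0)
    have "G (pi/2, c, d) = measure \<mu> (quadrant f (-e) c d)"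
      by (simp add: G_def v0)
    \<comment> \<open>The offsets \<open>c, d\<close> found at the end angle may differ from
      \<open>b, -a\<close>, but both pairs bisect, so the quadrant masses agree.\<close>
    also have "\<dots> = measure \<mu> (quadrant f (-e) b (-a))"
      by (rule measure_quadrant_cong[OF \<mu>])
         (simp_all add: a b c d measure_quadrant_neg[OF \<mu> e0])
    also have "\<dots> = ?M / 2 - G (0, a, b)"
      using measure_quadrant_split[OF \<mu> e0, of f b a] b
      by (simp add: G_def v0 quadrant_commute[of e f])
    finally have sum: "G (pi/2, c, d) = ?M / 2 - G (0, a, b)" .
    consider "G (0, a, b) \<le> ?M / 4" "G (pi/2, c, d) \<ge> ?M / 4"
      | "G (0, a, b) \<ge> ?M / 4" "G (pi/2, c, d) \<le> ?M / 4"
      using sum by linarith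
    then show ?thesis
    proof cases
      case 1
      then have "pi/2 \<in> U" "0 \<in> L"
        unfolding U_def L_def using 0 \<open>(pi/2, c, d) \<in> K\<close> by force+
      then show ?thesis by force
    next
      case 2
      then have "0 \<in> U" "pi/2 \<in> L"
        unfolding U_def L_def using 0 \<open>(pi/2, c, d) \<in> K\<close> by force+
      then show ?thesis by force
    qed
  qed
  moreover have "connected {0..pi/2}"
    by simp
  ultimately have "U \<inter> L \<inter> {0..pi/2} \<noteq> {}"
    unfolding connected_closed by blast
  then obtain t where "t \<in> U" "t \<in> L"
    by blast
  then obtain a b c d where ab: "(t, a, b) \<in> K" "G (t, a, b) \<ge> ?M / 4"
    and cd: "(t, c, d) \<in> K" "G (t, c, d) \<le> ?M / 4"
    unfolding U_def L_def by auto
  \<comment> \<open>Membership in \<open>U\<close> and in \<open>L\<close> may be witnessed by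
    different offsets; both pairs bisect, so the values coincide and equal a quarter.\<close>
  have "G (t, a, b) = G (t, c, d)"
    unfolding G_def prod.case
    by (rule measure_quadrant_cong[OF \<mu>]) (use ab(1) cd(1) in \<open>auto simp: K_def\<close>)
  then have "measure \<mu> (quadrant (v t) (w t) a b) = ?M / 4"
    using ab(2) cd(2) by (simp add: G_def)
  moreover have "v t \<in> span {e, f}"
    unfolding v_def by (rule span_add; rule span_scale; rule span_base; simp)
  moreover have "w t \<in> span {e, f}"
    unfolding w_def by (rule span_diff; rule span_scale; rule span_base; simp)
  ultimately show thesis
    using that[of "v t" "w t" a b] nv nw vw ab(1) by (auto simp: K_def)
qed

section \<open>Fans with a given normal plane\<close>

definition cross_dirs :: "'a::euclidean_space \<Rightarrow> 'a \<Rightarrow> nat \<Rightarrow> 'a" where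
  "cross_dirs v w j = (if j = 0 then v else if j = 1 then w else if j = 2 then - v else - w)"

lemma cross_dirs_simps [simp]:
  "cross_dirs v w 0 = v" "cross_dirs v w (Suc 0) = w" "cross_dirs v w 2 = - v" "cross_dirs v w 3 = - w"
  by (simp_all add: cross_dirs_def)

lemma all_less_4: "(\<forall>j<4. P j) \<longleftrightarrow> P 0 \<and> P (Suc 0) \<and> P 2 \<and> P (3::nat)"
  by (auto simp: numeral_eq_Suc less_Suc_eq)

text \<open>\<open>z\<close> is the orthogonal projection of \<open>y\<close> onto the codimension 2
  subspace that will bound the fan.\<close>

lemma decomposition_codim2:
  assumes "norm v = 1" "norm w = 1" "v \<bullet> w = 0"
  shows "\<exists>z. y = z + (y \<bullet> v - a) *\<^sub>R v + (y \<bullet> w - b) *\<^sub>R w \<and> z \<bullet> v = a \<and> z \<bullet> w = b"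
  using assms
  by (intro exI[of _ "y - (y \<bullet> v - a) *\<^sub>R v - (y \<bullet> w - b) *\<^sub>R w"])
     (simp add: inner_simps norm_eq_1 inner_commute)

lemma sector_eq_quadrant:
  assumes "norm v = 1" "norm w = 1" "v \<bullet> w = 0"
  shows "{z + s *\<^sub>R v + t *\<^sub>R w | z s t. z \<in> {y. y \<bullet> v = a \<and> y \<bullet> w = b} \<and> 0 \<le> s \<and> 0 \<le> t}
    = quadrant v w a b"
proof (intro equalityI subsetI)
  fix y assume "y \<in> quadrant v w a b"
  then show "y \<in> {z + s *\<^sub>R v + t *\<^sub>R w | z s t. z \<in> {y. y \<bullet> v = a \<and> y \<bullet> w = b} \<and> 0 \<le> s \<and> 0 \<le> t}"
    using decomposition_codim2[OF assms, of y a b] unfolding quadrant_def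
    by (smt (verit, best) mem_Collect_eq)
qed (use assms in \<open>auto simp: quadrant_def inner_simps norm_eq_1 inner_commute\<close>)

lemma regular_4_fan_cross:
  fixes v w :: "'a::euclidean_space"
  assumes vw: "norm v = 1" "norm w = 1" "v \<bullet> w = 0"
  shows "regular_4_fan {y. y \<bullet> v = a \<and> y \<bullet> w = b} (cross_dirs v w)"
proof -
  let ?A = "{y. y \<bullet> v = a \<and> y \<bullet> w = b}"
  have vv: "v \<bullet> v = 1" "w \<bullet> w = 1" "w \<bullet> v = 0"
    using vw by (simp_all add: norm_eq_1 inner_commute)
  define p where "p = a *\<^sub>R v + b *\<^sub>R w"
  \<comment> \<open>The direction space of the boundary, whose dimension is that of the orthogonal
    complement of a plane.\<close>
  define D where "D = {y. orthogonal v y \<and> orthogonal w y}"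
  have A: "?A = (+) p ` D"
  proof (intro equalityI subsetI)
    fix y assume "y \<in> ?A"
    then show "y \<in> (+) p ` D"
      by (intro image_eqI[of _ _ "y - p"])
         (auto simp: D_def p_def orthogonal_def inner_simps vv vw inner_commute)
  qed (auto simp: D_def p_def orthogonal_def inner_simps vv vw inner_commute)
  have sD: "subspace D"
    unfolding D_def subspace_def orthogonal_def by (auto simp: inner_simps)
  have "v \<noteq> w"
    using vv vw by auto
  have "independent {v, w}"
    by (rule pairwise_orthogonal_independent)
       (use vw vv in \<open>auto simp: pairwise_def orthogonal_def\<close>)
  then have "dim {v, w} = 2"
    using \<open>v \<noteq> w\<close> by (simp add: dim_eq_card_independent)
  moreover have "dim {y \<in> UNIV. \<forall>x\<in>span {v, w}. orthogonal x y} + dim (span {v, w}) = dim (UNIV :: 'a set)"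
    by (rule dim_subspace_orthogonal_to_vectors) auto
  moreover have "{y \<in> UNIV. \<forall>x\<in>span {v, w}. orthogonal x y} = D"
    unfolding D_def by (auto intro: span_base orthogonal_to_span simp: orthogonal_commute)
  ultimately have "dim D + 2 = DIM('a)"
    by simp
  then have "aff_dim ?A = int DIM('a) - 2"
    unfolding A aff_dim_translation_eq aff_dim_subspace[OF sD] by linarith
  moreover have "affine ?A"
    unfolding A using sD by (simp only: affine_translation[symmetric] subspace_imp_affine)
  moreover have "inj_on (cross_dirs v w) {..<4}"
  proof -
    have "v \<noteq> - w" "w \<noteq> - v"
      using vv vw by auto
    moreover have "v \<noteq> - v" "w \<noteq> - w"
      using vv by (metis inner_minus_left neg_equal_zero zero_neq_one)+
    ultimately show ?thesis
      using \<open>v \<noteq> w\<close> by (auto simp: inj_on_def cross_dirs_def lessThan_def split: if_splits)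
  qed
  moreover have "v \<bullet> (y - z) = 0 \<and> w \<bullet> (y - z) = 0" if "y \<in> ?A" "z \<in> ?A" for y z
    using that by (simp add: inner_diff_right inner_commute)
  ultimately show ?thesis
    unfolding regular_4_fan_def by (simp add: all_less_4 vw vv orthogonal_def cross_dirs_def)
qed

text \<open>Two halvings and one quarter determine the remaining three sectors by subtraction from
  half-spaces.\<close>

lemma equipartitions_cross:
  assumes \<mu>: "mass_distribution \<mu>" and vw: "norm v = 1" "norm w = 1" "v \<bullet> w = 0"
    and q: "measure \<mu> (quadrant v w a b) = measure \<mu> UNIV / 4"
    and hv: "measure \<mu> (quadrant v v a a) = measure \<mu> UNIV / 2"
    and hw: "measure \<mu> (quadrant w w b b) = measure \<mu> UNIV / 2"
  shows "equipartitions {y. y \<bullet> v = a \<and> y \<bullet> w = b} (cross_dirs v w) \<mu>"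
proof -
  let ?A = "{y. y \<bullet> v = a \<and> y \<bullet> w = b}"
  have nz: "v \<noteq> 0" "w \<noteq> 0"
    using vw by auto
  \<comment> \<open>The boundary is rewritten in the frame of each successive sector, so that
    \<open>sector_eq_quadrant\<close> applies to it.\<close>
  have A: "?A = {y. y \<bullet> w = b \<and> y \<bullet> (-v) = -a}" "?A = {y. y \<bullet> (-v) = -a \<and> y \<bullet> (-w) = -b}"
    "?A = {y. y \<bullet> (-w) = -b \<and> y \<bullet> v = a}"
    by auto
  have s: "sector ?A (cross_dirs v w) 0 = quadrant v w a b"
    "sector ?A (cross_dirs v w) (Suc 0) = quadrant w (-v) b (-a)"
    "sector ?A (cross_dirs v w) 2 = quadrant (-v) (-w) (-a) (-b)"
    "sector ?A (cross_dirs v w) 3 = quadrant (-w) v (-b) a"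
    unfolding sector_def
    subgoal using sector_eq_quadrant[OF vw, of a b] by simp
    subgoal using sector_eq_quadrant[of w "-v" b "-a"] vw
      by (subst A(1)) (simp add: inner_commute numeral_2_eq_2[symmetric])
    subgoal using sector_eq_quadrant[of "-v" "-w" "-a" "-b"] vw
      by (subst A(2)) simp
    subgoal using sector_eq_quadrant[of "-w" v "-b" a] vw
      by (subst A(3)) (simp add: inner_commute)
    done
  have "measure \<mu> (quadrant w (-v) b (-a)) = measure \<mu> UNIV / 4"
    using measure_quadrant_split[OF \<mu> nz(1), of w b a] hw q by (simp add: quadrant_commute[of v w])
  moreover have 3: "measure \<mu> (quadrant (-w) v (-b) a) = measure \<mu> UNIV / 4"
    using measure_quadrant_split[OF \<mu> nz(2), of v a b] hv q by (simp add: quadrant_commute[of v "-w"])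
  moreover have "measure \<mu> (quadrant (-v) (-w) (-a) (-b)) = measure \<mu> UNIV / 4"
    using measure_quadrant_split[OF \<mu> nz(1), of "-w" "-b" a] measure_quadrant_neg[OF \<mu> nz(2), of b] hw 3
    by (simp add: quadrant_commute[of "-v" "-w"])
  ultimately show ?thesis
    unfolding equipartitions_def using q by (simp add: all_less_4 s)
qed

text \<open>Every half-hyperplane contains the boundary, so its normals are orthogonal to the
  direction space of the boundary and hence lie in the plane of \<open>v\<close> and
  \<open>w\<close>.\<close>

lemma fan_perp_cross:
  assumes vw: "norm v = 1" "norm w = 1" "v \<bullet> w = 0"
  shows "fan_perp {y. y \<bullet> v = a \<and> y \<bullet> w = b} u \<subseteq> span {v, w}"
proof -
  let ?A = "{y. y \<bullet> v = a \<and> y \<bullet> w = b}"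
  have vv: "v \<bullet> v = 1" "w \<bullet> w = 1" "w \<bullet> v = 0"
    using vw by (simp_all add: norm_eq_1 inner_commute)
  have "x \<in> span {v, w}" if x: "x \<in> normal_vectors (half_hyperplane ?A c)" for x c
  proof -
    define p where "p = a *\<^sub>R v + b *\<^sub>R w"
    obtain z where z: "x = z + (x \<bullet> v - 0) *\<^sub>R v + (x \<bullet> w - 0) *\<^sub>R w" "z \<bullet> v = 0" "z \<bullet> w = 0"
      using decomposition_codim2[OF vw, of x 0 0] by blast
    have A: "?A \<subseteq> half_hyperplane ?A c"
      unfolding half_hyperplane_def by (force intro: exI[of _ 0])
    have "p + z \<in> ?A" "p \<in> ?A"
      using z vv vw by (auto simp: p_def inner_simps)
    \<comment> \<open>\<open>z\<close> is a difference of two boundary points, so the normal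
      \<open>x\<close> is orthogonal to it.\<close>
    then have "x \<bullet> (p + z - p) = 0"
      using x A unfolding normal_vectors_def orthogonal_def by blast
    moreover have "x \<bullet> z = z \<bullet> z"
      by (subst z(1)) (use z(2,3) in \<open>simp add: inner_simps inner_commute\<close>)
    ultimately have "z = 0"
      by simp
    have "x = z + (x \<bullet> v - 0) *\<^sub>R v + (x \<bullet> w - 0) *\<^sub>R w"
      by (rule z(1))
    also have "\<dots> = (x \<bullet> v) *\<^sub>R v + (x \<bullet> w) *\<^sub>R w"
      using \<open>z = 0\<close> by simp
    also have "(x \<bullet> v) *\<^sub>R v + (x \<bullet> w) *\<^sub>R w \<in> span {v, w}"
      by (rule span_add; rule span_scale; rule span_base; simp)
    finally show ?thesis .
  qed
  then show ?thesis
    unfolding fan_perp_def by (intro span_minimal) auto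
qed

lemma ex_equipartitioning_fan_in_plane:
  fixes \<mu> :: "'a::euclidean_space measure"
  assumes \<mu>: "mass_distribution \<mu>" and ef: "norm e = 1" "norm f = 1" "e \<bullet> f = 0"
  obtains A u where "regular_4_fan A u" "equipartitions A u \<mu>" "fan_perp A u \<subseteq> span {e, f}"
proof -
  obtain v w a b where vw: "v \<in> span {e, f}" "w \<in> span {e, f}" "norm v = 1" "norm w = 1" "v \<bullet> w = 0"
    "measure \<mu> (quadrant v w a b) = measure \<mu> UNIV / 4"
    "measure \<mu> (quadrant v v a a) = measure \<mu> UNIV / 2"
    "measure \<mu> (quadrant w w b b) = measure \<mu> UNIV / 2"
    using ex_equal_quadrants[OF \<mu> ef] by blast
  have "span {v, w} \<subseteq> span {e, f}"
    using vw by (intro span_minimal) auto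
  then show thesis
    using that[OF regular_4_fan_cross equipartitions_cross[OF \<mu>]] fan_perp_cross[of v w a b] vw
    by blast
qed

section \<open>Bounds for the numbers of fans\<close>

text \<open>\<open>u 1\<close> is orthogonal to the boundary and to \<open>u 0\<close>, hence normal
  to the half-hyperplane in direction \<open>u 0\<close>.\<close>

lemma fan_perp_nonzero:
  assumes "regular_4_fan A u"
  obtains x where "x \<in> fan_perp A u" "x \<noteq> 0"
proof (rule that[of "u 1"])
  have u: "norm (u 0) = 1" "norm (u 1) = 1" "arccos (u 0 \<bullet> u 1) = pi / 2"
    "\<forall>a\<in>A. \<forall>b\<in>A. orthogonal (u 1) (a - b)"
    using assms unfolding regular_4_fan_def by (auto simp: all_less_4)
  \<comment> \<open>\<open>cos\<close> inverts \<open>arccos\<close> only on [-1, 1].\<close>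
  have "\<bar>u 0 \<bullet> u 1\<bar> \<le> 1"
    using Cauchy_Schwarz_ineq2[of "u 0" "u 1"] u by simp
  then have "u 0 \<bullet> u 1 = 0"
    by (metis abs_le_D1 abs_le_D2 cos_arccos cos_pi_half minus_le_iff u(3))
  moreover have "u 1 \<bullet> (a + s *\<^sub>R u 0 - (b + t *\<^sub>R u 0)) = u 1 \<bullet> (a - b) + (s - t) * (u 0 \<bullet> u 1)"
    for a b s t
    by (simp add: inner_add_right inner_diff_right inner_commute algebra_simps)
  moreover have "u 1 \<bullet> (a - b) = 0" if "a \<in> A" "b \<in> A" for a b
    using u(4) that unfolding orthogonal_def by blast
  ultimately have "u 1 \<bullet> (a + s *\<^sub>R u 0 - (b + t *\<^sub>R u 0)) = 0" if "a \<in> A" "b \<in> A" for a b s t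
    using that by (metis add_0 mult_zero_right)
  then have "u 1 \<in> normal_vectors (half_hyperplane A (u 0))"
    unfolding normal_vectors_def half_hyperplane_def orthogonal_def by blast
  then show "u 1 \<in> fan_perp A u"
    unfolding fan_perp_def by (intro span_base) auto
  show "u 1 \<noteq> 0"
    using u by auto
qed

text \<open>Nonzero vectors, one from each summand of a direct sum, are linearly
  independent.\<close>

lemma direct_family_le_DIM:
  fixes W :: "nat \<Rightarrow> 'a::euclidean_space set"
  assumes W: "direct_family k W" and sub: "\<And>i. i < k \<Longrightarrow> subspace (W i)"
    and nz: "\<And>i. i < k \<Longrightarrow> x i \<in> W i" "\<And>i. i < k \<Longrightarrow> x i \<noteq> 0"
  shows "k \<le> DIM('a)"
proof -
  have lin: "c i = 0" if "(\<Sum>i<k. c i *\<^sub>R x i) = 0" "i < k" for c i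
  proof -
    have "\<forall>i<k. c i *\<^sub>R x i \<in> W i"
      using sub nz(1) by (blast intro: subspace_scale)
    moreover from W have "(\<forall>i<k. c i *\<^sub>R x i \<in> W i) \<and> (\<Sum>i<k. c i *\<^sub>R x i) = 0
        \<longrightarrow> (\<forall>i<k. c i *\<^sub>R x i = 0)"
      unfolding direct_family_def by (rule spec[where x = "\<lambda>i. c i *\<^sub>R x i"])
    ultimately have "c i *\<^sub>R x i = 0"
      using that by blast
    then show ?thesis
      using nz(2) that by simp
  qed
  have inj: "inj_on x {..<k}"
  proof (rule inj_onI, rule ccontr)
    fix i j assume ij: "i \<in> {..<k}" "j \<in> {..<k}" "x i = x j" "i \<noteq> j"
    \<comment> \<open>If \<open>x i = x j\<close>, these coefficients would give a nontrivial
      vanishing combination.\<close>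
    let ?c = "\<lambda>l. if l = i then 1 else if l = j then -1 else 0 :: real"
    have "(\<Sum>l<k. ?c l *\<^sub>R x l) = (\<Sum>l<k. (if l = i then x l else 0) + (if l = j then - x l else 0))"
      using ij by (intro sum.cong) auto
    also have "\<dots> = 0"
      using ij by (simp add: sum.distrib)
    finally show False
      using lin[of ?c i] ij by simp
  qed
  have "independent (x ` {..<k})"
  proof (rule independent_if_scalars_zero)
    fix g y assume "(\<Sum>y\<in>x ` {..<k}. g y *\<^sub>R y) = 0" "y \<in> x ` {..<k}"
    then show "g y = 0"
      using lin[of "g \<circ> x"] by (auto simp: sum.reindex[OF inj])
  qed simp
  then show ?thesis
    using independent_bound card_image[OF inj] by fastforce
qed

text \<open>Pairing a vanishing sum with \<open>w i\<close> leaves only the squared norm of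
  \<open>w i\<close>.\<close>

lemma orthogonal_imp_direct_family:
  assumes "orthogonal_family k W"
  shows "direct_family k W"
  unfolding direct_family_def
proof (intro allI impI, elim conjE)
  fix w i assume w: "\<forall>i<k. w i \<in> W i" "(\<Sum>i<k. w i) = 0" and i: "i < k"
  have "w j \<bullet> w i = 0" if "j < k" "j \<noteq> i" for j
    using assms that i w(1) unfolding orthogonal_family_def orthogonal_def by blast
  then have "(\<Sum>j<k. w j) \<bullet> w i = (\<Sum>j<k. if j = i then w i \<bullet> w i else 0)"
    unfolding inner_sum_left by (intro sum.cong) auto
  then show "w i = 0"
    using w i by simp
qed

text \<open>Supplies a mass distribution at which the universal condition in \<open>Omega\<close>
  and \<open>Omega_perp\<close> can be instantiated to bound \<open>k\<close>.\<close>

lemma mass_distribution_null: "mass_distribution (null_measure (borel :: 'a::euclidean_space measure))"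
  unfolding mass_distribution_def absolutely_continuous_def null_sets_def
  by (auto intro!: finite_measureI)

lemma direct_fans_le_DIM:
  assumes "\<forall>\<mu> :: 'a::euclidean_space measure. mass_distribution \<mu> \<longrightarrow>
     (\<exists>A u. (\<forall>i<k. regular_4_fan (A i) (u i) \<and> equipartitions (A i) (u i) \<mu>) \<and>
            direct_family k (\<lambda>i. fan_perp (A i) (u i)))"
  shows "k \<le> DIM('a)"
proof -
  obtain A :: "nat \<Rightarrow> 'a set" and u where fan: "\<forall>i<k. regular_4_fan (A i) (u i)"
    and dir: "direct_family k (\<lambda>i. fan_perp (A i) (u i))"
    using assms mass_distribution_null by blast
  have "\<forall>i. \<exists>x. i < k \<longrightarrow> x \<in> fan_perp (A i) (u i) \<and> x \<noteq> 0"
    using fan fan_perp_nonzero by metis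
  then obtain x where x: "\<And>i. i < k \<Longrightarrow> x i \<in> fan_perp (A i) (u i) \<and> x i \<noteq> 0"
    by metis
  then show ?thesis
    by (intro direct_family_le_DIM[OF dir, where x = x]) (auto simp: fan_perp_def)
qed

lemma orthogonal_spans:
  assumes "x \<in> span S" "y \<in> span T" and "\<And>s t. s \<in> S \<Longrightarrow> t \<in> T \<Longrightarrow> orthogonal s t"
  shows "orthogonal x y"
  using assms by (meson orthogonal_commute orthogonal_to_span)

text \<open>The standard basis is split into \<open>n\<close> consecutive pairs, and each coordinate
  plane so obtained receives its own fan.\<close>

lemma ex_orthogonal_fans:
  fixes \<mu> :: "'a::euclidean_space measure"
  assumes \<mu>: "mass_distribution \<mu>" and n: "DIM('a) = 2 * n"
  shows "\<exists>A u. (\<forall>i<n. regular_4_fan (A i) (u i) \<and> equipartitions (A i) (u i) \<mu>) \<and>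
            orthogonal_family n (\<lambda>i. fan_perp (A i) (u i))"
proof -
  have "\<exists>h. bij_betw h {0..<2 * n} (Basis :: 'a set)"
    using ex_bij_betw_nat_finite[of "Basis :: 'a set"] by (simp add: n)
  then obtain h where h: "bij_betw h {0..<2 * n} (Basis :: 'a set)"
    by (rule exE)
  have mem: "h i \<in> Basis" if "i < 2 * n" for i
    using h that by (simp add: bij_betw_apply)
  have ort: "h i \<bullet> h j = 0" if "i < 2 * n" "j < 2 * n" "i \<noteq> j" for i j
    using that mem inj_onD[OF bij_betw_imp_inj_on[OF h], of i j] by (auto simp: inner_Basis)
  have "\<exists>A u. i < n \<longrightarrow> regular_4_fan A u \<and> equipartitions A u \<mu> \<and>
      fan_perp A u \<subseteq> span {h (2 * i), h (Suc (2 * i))}" for i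
  proof (cases "i < n")
    case True
    then have "norm (h (2 * i)) = 1" "norm (h (Suc (2 * i))) = 1" "h (2 * i) \<bullet> h (Suc (2 * i)) = 0"
      using mem ort by auto
    then show ?thesis
      using ex_equipartitioning_fan_in_plane[OF \<mu>] by metis
  qed auto
  then obtain A u where Au: "\<And>i. i < n \<Longrightarrow> regular_4_fan (A i) (u i) \<and> equipartitions (A i) (u i) \<mu> \<and>
      fan_perp (A i) (u i) \<subseteq> span {h (2 * i), h (Suc (2 * i))}"
    by metis
  have "orthogonal x y" if "i < n" "j < n" "i \<noteq> j" "x \<in> fan_perp (A i) (u i)" "y \<in> fan_perp (A j) (u j)"
    for i j x y
  proof (rule orthogonal_spans[of x "{h (2 * i), h (Suc (2 * i))}" y "{h (2 * j), h (Suc (2 * j))}"])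
    fix s t assume st: "s \<in> {h (2 * i), h (Suc (2 * i))}" "t \<in> {h (2 * j), h (Suc (2 * j))}"
    have "Suc (2 * i) \<noteq> 2 * j" "2 * i \<noteq> Suc (2 * j)"
      by presburger+
    then show "orthogonal s t"
      using st that(1-3) ort by (auto simp: orthogonal_def)
  qed (use Au that in blast)+
  then show ?thesis
    using Au unfolding orthogonal_family_def by blast
qed

lemma ex_direct_fans:
  fixes \<mu> :: "'a::euclidean_space measure"
  assumes "mass_distribution \<mu>" and "DIM('a) = 2 * n"
  shows "\<exists>A u. (\<forall>i<n. regular_4_fan (A i) (u i) \<and> equipartitions (A i) (u i) \<mu>) \<and>
            direct_family n (\<lambda>i. fan_perp (A i) (u i))"
  using ex_orthogonal_fans[OF assms] by (elim exE conjE, intro exI conjI orthogonal_imp_direct_family)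

lemma orthogonal_fans_le_DIM:
  assumes "\<forall>\<mu> :: 'a::euclidean_space measure. mass_distribution \<mu> \<longrightarrow>
     (\<exists>A u. (\<forall>i<k. regular_4_fan (A i) (u i) \<and> equipartitions (A i) (u i) \<mu>) \<and>
            orthogonal_family k (\<lambda>i. fan_perp (A i) (u i)))"
  shows "k \<le> DIM('a)"
proof (rule direct_fans_le_DIM, intro allI impI)
  fix \<mu> :: "'a measure"
  assume "mass_distribution \<mu>"
  with assms obtain A :: "nat \<Rightarrow> 'a set" and u
    where "\<forall>i<k. regular_4_fan (A i) (u i) \<and> equipartitions (A i) (u i) \<mu>"
      and "orthogonal_family k (\<lambda>i. fan_perp (A i) (u i))"
    by blast
  then show "\<exists>A u. (\<forall>i<k. regular_4_fan (A i) (u i) \<and> equipartitions (A i) (u i) \<mu>) \<and>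
            direct_family k (\<lambda>i. fan_perp (A i) (u i))"
    by (intro exI conjI orthogonal_imp_direct_family)
qed

text \<open>The dimension bound makes the set finite, so its member \<open>n\<close> lies below the
  maximum.\<close>

lemma DIM_half_le_Omega_perp:
  assumes "DIM('a::euclidean_space) = 2 * n"
  shows "n \<le> Omega_perp TYPE('a)"
  unfolding Omega_perp_def
proof (rule Max_ge)
  show "finite {k. \<forall>\<mu> :: 'a measure. mass_distribution \<mu> \<longrightarrow>
     (\<exists>A u. (\<forall>i<k. regular_4_fan (A i) (u i) \<and> equipartitions (A i) (u i) \<mu>) \<and>
            orthogonal_family k (\<lambda>i. fan_perp (A i) (u i)))}"
    by (rule finite_subset[OF _ finite_atMost[of "DIM('a)"]],
        intro subsetI, unfold mem_Collect_eq atMost_iff, rule orthogonal_fans_le_DIM)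
qed (use ex_orthogonal_fans[OF _ assms] in \<open>unfold mem_Collect_eq, intro allI impI\<close>)

lemma DIM_half_le_Omega:
  assumes "DIM('a::euclidean_space) = 2 * n"
  shows "n \<le> Omega TYPE('a)"
  unfolding Omega_def
proof (rule Max_ge)
  show "finite {k. \<forall>\<mu> :: 'a measure. mass_distribution \<mu> \<longrightarrow>
     (\<exists>A u. (\<forall>i<k. regular_4_fan (A i) (u i) \<and> equipartitions (A i) (u i) \<mu>) \<and>
            direct_family k (\<lambda>i. fan_perp (A i) (u i)))}"
    by (rule finite_subset[OF _ finite_atMost[of "DIM('a)"]],
        intro subsetI, unfold mem_Collect_eq atMost_iff, rule direct_fans_le_DIM)
qed (use ex_direct_fans[OF _ assms] in \<open>unfold mem_Collect_eq, intro allI impI\<close>)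

section \<open>Bounds for the lengths of sections\<close>

text \<open>The index type is arbitrary so that families indexed by pairs are covered as
  well.\<close>

lemma card_orthonormal_le_DIM:
  fixes v :: "'i \<Rightarrow> 'a::euclidean_space"
  assumes "finite I" and v: "\<And>i j. i \<in> I \<Longrightarrow> j \<in> I \<Longrightarrow> v i \<bullet> v j = (if i = j then 1 else 0)"
  shows "card I \<le> DIM('a)"
proof -
  have inj: "inj_on v I"
    using v by (intro inj_onI) (metis zero_neq_one)
  have "independent (v ` I)"
  proof (rule pairwise_orthogonal_independent)
    show "pairwise orthogonal (v ` I)"
      using v by (auto simp: pairwise_def orthogonal_def)
    show "0 \<notin> v ` I"
      using v by (metis imageE inner_zero_left zero_neq_one)
  qed
  then show ?thesis
    using independent_bound card_image[OF inj] by fastforce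
qed

lemma inner_eq_Re_hermitian: "v \<bullet> w = Re (hermitian_inner v w)"
  by (simp add: hermitian_inner_def inner_vec_def inner_complex_def)

lemma hermitian_scale:
  "hermitian_inner (c *s v) w = c * hermitian_inner v w"
  "hermitian_inner v (c *s w) = cnj c * hermitian_inner v w"
  by (simp_all add: hermitian_inner_def sum_distrib_left mult_ac)

lemma stiefel_real_le:
  assumes "v \<in> (stiefel_real k :: (nat \<Rightarrow> complex ^ 'n::finite) set)"
  shows "k \<le> 2 * CARD('n)"
  using card_orthonormal_le_DIM[of "{1..k}" v] assms by (simp add: stiefel_real_def)

text \<open>A Hermitian orthonormal \<open>k\<close>-tuple together with its multiples by
  \<open>\<i>\<close> forms \<open>2 * k\<close> vectors that are orthonormal over the reals, in
  real dimension \<open>2 * CARD('n)\<close>.\<close>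

lemma stiefel_complex_le:
  assumes "v \<in> (stiefel_complex k :: (nat \<Rightarrow> complex ^ 'n::finite) set)"
  shows "k \<le> CARD('n)"
proof -
  define v' where "v' = (\<lambda>(i, c). (if c then \<i> else 1) *s v i)"
  have herm: "hermitian_inner (v i) (v j) = (if i = j then 1 else 0)" if "i \<in> {1..k}" "j \<in> {1..k}" for i j
    using assms that by (simp add: stiefel_complex_def)
  have "card ({1..k} \<times> (UNIV :: bool set)) \<le> DIM(complex ^ 'n)"
  proof (rule card_orthonormal_le_DIM[where v = v'])
    fix p q assume "p \<in> {1..k} \<times> (UNIV :: bool set)" "q \<in> {1..k} \<times> (UNIV :: bool set)"
    then show "v' p \<bullet> v' q = (if p = q then 1 else 0)"
      by (cases p; cases q) (auto simp: v'_def inner_eq_Re_hermitian hermitian_scale herm)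
  qed simp
  then show ?thesis
    by (simp add: card_cartesian_product)
qed

text \<open>The sphere is nonempty, and the value of a section at any of its points is an
  orthonormal tuple, which bounds \<open>k\<close>.\<close>

lemma Z4_section_imp_mem:
  assumes "Z4_section (V :: (nat \<Rightarrow> complex ^ 'n::finite) set) k r s"
  obtains v where "v \<in> V"
proof -
  obtain x :: "complex ^ 'n" where "norm x = 1"
    using vector_choose_size[of 1] by auto
  then have "x \<in> sphere 0 1"
    by simp
  then have "s x \<in> V"
    using assms unfolding Z4_section_def by blast
  then show ?thesis
    by (rule that)
qed

lemma rho_real_le: "rho_real TYPE('n::finite) \<le> 2 * CARD('n)"
proof -
  define S where "S = {k. 1 \<le> k \<and>
    (\<exists>r\<in>{1, 3}. \<exists>s. Z4_section (stiefel_real k :: (nat \<Rightarrow> complex ^ 'n) set) k r s)}"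
  have bound: "k \<le> 2 * CARD('n)" if "k \<in> S" for k
  proof -
    from that obtain r s where "Z4_section (stiefel_real k :: (nat \<Rightarrow> complex ^ 'n) set) k r s"
      unfolding S_def by blast
    then obtain v :: "nat \<Rightarrow> complex ^ 'n" where "v \<in> stiefel_real k"
      by (rule Z4_section_imp_mem)
    then show ?thesis
      by (rule stiefel_real_le)
  qed
  \<comment> \<open>The identity is a section of length 1; this makes the set nonempty, so that
    \<open>Max\<close> is meaningful.\<close>
  have "Z4_section (stiefel_real 1 :: (nat \<Rightarrow> complex ^ 'n) set) 1 1 (\<lambda>x _. x)"
    by (auto simp: Z4_section_def stiefel_real_def norm_eq_1)
  then have "1 \<in> S"
    unfolding S_def by blast
  moreover have "finite S"
    using bound by (intro finite_subset[of S "{..2 * CARD('n)}"]) auto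
  ultimately have "Max S \<le> 2 * CARD('n)"
    using bound by (intro Max.boundedI) auto
  then show ?thesis
    by (simp only: rho_real_def S_def)
qed

lemma rho_complex_le: "rho_complex TYPE('n::finite) \<le> CARD('n)"
proof -
  define S where "S = {k. 1 \<le> k \<and>
    (\<exists>r\<in>{1, 3}. \<exists>s. Z4_section (stiefel_complex k :: (nat \<Rightarrow> complex ^ 'n) set) k r s)}"
  have bound: "k \<le> CARD('n)" if "k \<in> S" for k
  proof -
    from that obtain r s where "Z4_section (stiefel_complex k :: (nat \<Rightarrow> complex ^ 'n) set) k r s"
      unfolding S_def by blast
    then obtain v :: "nat \<Rightarrow> complex ^ 'n" where "v \<in> stiefel_complex k"
      by (rule Z4_section_imp_mem)
    then show ?thesis
      by (rule stiefel_complex_le)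
  qed
  have "hermitian_inner x x = 1" if "norm x = 1" for x :: "complex ^ 'n"
  proof -
    \<comment> \<open>The norm controls only the real part of the Hermitian product.\<close>
    have "Im (hermitian_inner x x) = 0"
      by (simp add: hermitian_inner_def mult.commute)
    then show ?thesis
      using that by (simp add: complex_eq_iff norm_eq_1 inner_eq_Re_hermitian)
  qed
  then have "Z4_section (stiefel_complex 1 :: (nat \<Rightarrow> complex ^ 'n) set) 1 1 (\<lambda>x _. x)"
    by (auto simp: Z4_section_def stiefel_complex_def)
  then have "1 \<in> S"
    unfolding S_def by blast
  moreover have "finite S"
    using bound by (intro finite_subset[of S "{..CARD('n)}"]) auto
  ultimately have "Max S \<le> CARD('n)"
    using bound by (intro Max.boundedI) auto
  then show ?thesis
    by (simp only: rho_complex_def S_def)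
qed

theorem theorem2p3:
  fixes n :: nat
  assumes "1 \<le> n"
    and "CARD('n::finite) = n"
    and "DIM('a::euclidean_space) = 2 * n"
  shows "min (rho_complex TYPE('n)) (2 * n - 1) \<le> Omega_perp TYPE('a) \<and>
         \<lceil>1 / 2 * real (min (rho_real TYPE('n)) (2 * n - 1))\<rceil> \<le> int (Omega TYPE('a))"
proof
  show "min (rho_complex TYPE('n)) (2 * n - 1) \<le> Omega_perp TYPE('a)"
    using rho_complex_le[where 'n = 'n] DIM_half_le_Omega_perp[OF assms(3)] assms(2) by linarith
  \<comment> \<open>With \<open>n <= Omega\<close> the real bound reads
    \<open>rho_real <= 2 * n <= 2 * Omega\<close>. As \<open>Omega\<close> is an integer, rounding
    up the half does not exceed it.\<close>
  have "min (rho_real TYPE('n)) (2 * n - 1) \<le> 2 * Omega TYPE('a)"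
    using rho_real_le[where 'n = 'n] DIM_half_le_Omega[OF assms(3)] assms(2) by linarith
  then show "\<lceil>1 / 2 * real (min (rho_real TYPE('n)) (2 * n - 1))\<rceil> \<le> int (Omega TYPE('a))"
    by (simp add: ceiling_le_iff)
qed

end
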